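(* If $f\colon\mathbb R\langle\mathbb A\rangle_*\,\overline\otimes\,\mathbb R\langle\mathbb A\rangle\to\mathbb R\langle\mathbb A\rangle_*\,\overline\otimes\,\mathbb R\langle\mathbb A\rangle$ has a power series $f(x)=\sum_{k\ge0}c_kx^k$ with $c_k\in\mathbb R$, then $$f\Bigl(\sum_{w\in\mathbb A^*}w\otimes w\Bigr)=\sum_{w\in\mathbb A^*}F^{\star}(\mathrm{id})(w)\otimes w ,$$ where $F^{\star}(X)=\sum_{k\ge0}c_kX^{\star k}$ is the associated convolution power series. Further, when the power series $f$ has an inverse $f^{-1}(x)=\sum_{k\ge0}b_kx^k$ with $b_k\in\mathbb R$, the compositional inverse of the convolution power series $F^\star$ is given by the associated convolution power series $F^{-1}(X)=\sum_{k\ge0}b_kX^{\star k}$.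
   Context: $\mathbb A$ is a countable alphabet, $\mathbb A^*$ the set of words over $\mathbb A$ (with empty word $\mathbf 1$), $\mathbb R\langle\mathbb A\rangle$ the real vector space with basis $\mathbb A^*$, regarded as an algebra under concatenation. Given a commutative associative product $[\cdot,\cdot]$ on the span of the letters, $\mathbb R\langle\mathbb A\rangle_*$ is the same vector space with the quasi-shuffle product, determined by $u*\mathbf 1=\mathbf 1*u=u$ and $ua*vb=(u*vb)a+(ua*v)b+(u*v)[a,b]$ for words $u,v$ and letters $a,b$. $\mathbb R\langle\mathbb A\rangle_*\,\overline\otimes\,\mathbb R\langle\mathbb A\rangle$ is the completed tensor product (infinite linear combinations of $u\otimes v$ allowed), with product $(u\otimes x)(v\otimes y)=(u*v)\otimes(xy)$. The convolution product of linear endomorphisms $X,Y$ of $\mathbb R\langle\mathbb A\rangle_*$ is $(X\star Y)(w)=\sum_{uv=w}X(u)*Y(v)$, the sum being over all factorizations of the word $w$ by concatenation (including empty factors). $X^{\star k}$ denotes the $k$-th convolution power, $X^{\star 0}=\nu$ being the convolution unit, which fixes $\mathbf 1$ and sends nonempty words to $0$. "Has a power series" includes that the series involved are well defined (convergent) at the elements to which they are applied. *)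

theory Defs
  imports "HOL-Analysis.Analysis" "HOL-Analysis.Finite_Function_Topology"
begin

type_synonym 'a words = "'a list \<Rightarrow>\<^sub>0 real"

abbreviation of_word :: "'a list \<Rightarrow> 'a words" where
  "of_word w \<equiv> Poly_Mapping.single w 1"

definition lin_ext :: "('b \<Rightarrow> 'c::real_vector) \<Rightarrow> ('b \<Rightarrow>\<^sub>0 real) \<Rightarrow> 'c" where
  "lin_ext g p = (\<Sum>w\<in>Poly_Mapping.keys p. Poly_Mapping.lookup p w *\<^sub>R g w)"

lemma lin_ext_single [simp]: "lin_ext g (Poly_Mapping.single w 1) = g w"
  by (simp add: lin_ext_def)

definition concat_prod :: "'a words \<Rightarrow> 'a words \<Rightarrow> 'a words" where
  "concat_prod p q = lin_ext (\<lambda>u. lin_ext (\<lambda>v. of_word (u @ v)) q) p"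

definition of_letters :: "('a \<Rightarrow>\<^sub>0 real) \<Rightarrow> 'a words" where
  "of_letters = lin_ext (\<lambda>a. of_word [a])"

text \<open>\<^typ>\<open>'a \<Rightarrow>\<^sub>0 real\<close> is the span of the letters.\<close>

type_synonym 'a bracket = "('a \<Rightarrow>\<^sub>0 real) \<Rightarrow> ('a \<Rightarrow>\<^sub>0 real) \<Rightarrow> ('a \<Rightarrow>\<^sub>0 real)"

text \<open>The recursion peels off the last letters of both words; see \<open>qsh_snoc\<close> below.\<close>

function qsh :: "'a bracket \<Rightarrow> 'a list \<Rightarrow> 'a list \<Rightarrow> 'a words"
  where
  "qsh B u v =
     (if u = [] then of_word v
      else if v = [] then of_word u
      else concat_prod (qsh B (butlast u) v) (of_word [last u])
         + concat_prod (qsh B u (butlast v)) (of_word [last v])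
         + concat_prod (qsh B (butlast u) (butlast v))
             (of_letters (B (Poly_Mapping.single (last u) 1) (Poly_Mapping.single (last v) 1))))"
  by pat_completeness auto
termination
  by (relation "Wellfounded.measure (\<lambda>(B, u, v). length u + length v)")
     (auto simp flip: length_greater_0_conv)

declare qsh.simps [simp del]

lemma qsh_Nil: "qsh B [] v = of_word v" "qsh B u [] = of_word u"
  by (simp_all add: qsh.simps)

lemma qsh_snoc:
  "qsh B (u @ [a]) (v @ [b]) =
     concat_prod (qsh B u (v @ [b])) (of_word [a])
   + concat_prod (qsh B (u @ [a]) v) (of_word [b])
   + concat_prod (qsh B u v) (of_letters (B (Poly_Mapping.single a 1) (Poly_Mapping.single b 1)))"
  by (subst qsh.simps) simp

definition qsh_prod ::
  "'a bracket \<Rightarrow> 'a words \<Rightarrow> 'a words \<Rightarrow> 'a words" where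
  "qsh_prod B p q = lin_ext (\<lambda>u. lin_ext (\<lambda>v. qsh B u v) q) p"

text \<open>Elements of the completed tensor product are arbitrary families of coefficients: \<open>S u x\<close> is
  the coefficient of \<open>u \<otimes> x\<close>. In the product, a word \<open>x y\<close> has finitely many factorizations, but a
  word may occur in \<open>u * v\<close> for infinitely many pairs \<open>(u, v)\<close> (e.g. if infinitely many brackets
  of letters have a letter in common), hence the unconditional sum. It has only finitely many
  nonzero terms whenever each \<open>x\<close> and each \<open>y\<close> is paired with finitely many words, as is the case
  for the elements \<open>word_sum g\<close> below.\<close>

type_synonym 'a ctensor = "'a list \<Rightarrow> 'a list \<Rightarrow> real"

definition pure_tensor :: "'a words \<Rightarrow> 'a words \<Rightarrow> 'a ctensor" where
  "pure_tensor p q = (\<lambda>u x. Poly_Mapping.lookup p u * Poly_Mapping.lookup q x)"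

definition tensor_prod ::
  "'a bracket \<Rightarrow> 'a ctensor \<Rightarrow> 'a ctensor \<Rightarrow> 'a ctensor" where
  "tensor_prod B S R = (\<lambda>w z. \<Sum>(x, y)\<in>{(x, y). x @ y = z}.
     \<Sum>\<^sub>\<infinity>(u, v). S u x * R v y * Poly_Mapping.lookup (qsh B u v) w)"

lemma finite_factorizations: "finite {(x, y). x @ y = z}"
proof (rule finite_subset)
  show "{(x, y). x @ y = z} \<subseteq> (\<lambda>i. (take i z, drop i z)) ` {..length z}"
  proof
    fix t assume "t \<in> {(x, y). x @ y = z}"
    then have "t = (take (length (fst t)) z, drop (length (fst t)) z)" "length (fst t) \<le> length z"
      by auto
    then show "t \<in> (\<lambda>i. (take i z, drop i z)) ` {..length z}" by blast
  qed
qed simp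

lemma tensor_prod_pure:
  "tensor_prod B (pure_tensor (of_word u) (of_word x)) (pure_tensor (of_word v) (of_word y)) =
     pure_tensor (qsh B u v) (of_word (x @ y))"
proof (intro ext)
  fix w z
  let ?c = "Poly_Mapping.lookup (qsh B u v) w"
  have inner: "(\<Sum>\<^sub>\<infinity>(u', v'). pure_tensor (of_word u) (of_word x) u' x'
        * pure_tensor (of_word v) (of_word y) v' y' * Poly_Mapping.lookup (qsh B u' v') w)
      = (if x' = x \<and> y' = y then ?c else 0)" (is "infsum ?F UNIV = _") for x' y'
  proof -
    have "infsum ?F UNIV = infsum ?F {(u, v)}"
      by (rule infsum_cong_neutral)
         (auto simp: pure_tensor_def lookup_single when_def split: if_splits)
    then show ?thesis
      by (auto simp: pure_tensor_def lookup_single when_def)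
  qed
  have "tensor_prod B (pure_tensor (of_word u) (of_word x)) (pure_tensor (of_word v) (of_word y)) w z
      = (\<Sum>t\<in>{(x, y). x @ y = z}. if t = (x, y) then ?c else 0)"
    unfolding tensor_prod_def inner by (intro sum.cong refl) (simp add: case_prod_beta prod_eq_iff)
  also have "\<dots> = pure_tensor (qsh B u v) (of_word (x @ y)) w z"
    by (simp add: sum.delta[OF finite_factorizations] pure_tensor_def lookup_single when_def)
  finally show "tensor_prod B (pure_tensor (of_word u) (of_word x)) (pure_tensor (of_word v) (of_word y)) w z
      = pure_tensor (qsh B u v) (of_word (x @ y)) w z" .
qed

primrec tensor_power ::
  "'a bracket \<Rightarrow> 'a ctensor \<Rightarrow> nat \<Rightarrow> 'a ctensor" where
  "tensor_power B S 0 = pure_tensor (of_word []) (of_word [])"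
| "tensor_power B S (Suc k) = tensor_prod B S (tensor_power B S k)"

text \<open>\<open>word_sum g\<close> is the infinite sum of \<open>g w \<otimes> w\<close> over all words \<open>w\<close>.\<close>

definition word_sum :: "('a list \<Rightarrow> 'a words) \<Rightarrow> 'a ctensor" where
  "word_sum g = (\<lambda>u x. Poly_Mapping.lookup (g x) u)"

text \<open>Series of tensors and of endomorphisms converge coefficientwise.\<close>

definition has_power_series_on ::
  "'a bracket \<Rightarrow>
     ('a ctensor \<Rightarrow> 'a ctensor) \<Rightarrow> (nat \<Rightarrow> real) \<Rightarrow> 'a ctensor set \<Rightarrow> bool" where
  "has_power_series_on B f c D \<longleftrightarrow>
     (\<forall>S\<in>D. \<forall>u x. (\<lambda>k. c k * tensor_power B S k u x) sums f S u x)"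

type_synonym 'a endo = "'a words \<Rightarrow> 'a words"

definition convolution ::
  "'a bracket \<Rightarrow> 'a endo \<Rightarrow> 'a endo \<Rightarrow> 'a endo" where
  "convolution B X Y =
     lin_ext (\<lambda>w. \<Sum>(u, v)\<in>{(u, v). u @ v = w}. qsh_prod B (X (of_word u)) (Y (of_word v)))"

definition conv_unit :: "'a endo" where
  "conv_unit = lin_ext (\<lambda>w. if w = [] then of_word [] else 0)"

primrec conv_power ::
  "'a bracket \<Rightarrow> 'a endo \<Rightarrow> nat \<Rightarrow> 'a endo" where
  "conv_power B X 0 = conv_unit"
| "conv_power B X (Suc k) = convolution B X (conv_power B X k)"

definition conv_sums ::
  "'a bracket \<Rightarrow> (nat \<Rightarrow> real) \<Rightarrow> 'a endo \<Rightarrow> 'a endo \<Rightarrow> bool"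
  where
  "conv_sums B c X Y \<longleftrightarrow>
     (\<forall>p u. (\<lambda>k. c k * Poly_Mapping.lookup (conv_power B X k p) u) sums Poly_Mapping.lookup (Y p) u)"

definition conv_series ::
  "'a bracket \<Rightarrow> (nat \<Rightarrow> real) \<Rightarrow> 'a endo \<Rightarrow> 'a endo" where
  "conv_series B c X = (THE Y. conv_sums B c X Y)"

lemma conv_series_eq:
  assumes "conv_sums B c X Y"
  shows "conv_series B c X = Y"
  unfolding conv_series_def
proof (rule the_equality)
  fix Z assume "conv_sums B c X Z"
  with assms show "Z = Y"
    unfolding conv_sums_def by (intro ext poly_mapping_eqI) (blast intro: sums_unique2)
qed (fact assms)

definition conv_domain ::
  "'a bracket \<Rightarrow> (nat \<Rightarrow> real) \<Rightarrow> 'a endo set" where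
  "conv_domain B c = {X. linear X \<and> (\<exists>Y. conv_sums B c X Y)}"

definition inverse_maps :: "('b \<Rightarrow> 'c) \<Rightarrow> ('c \<Rightarrow> 'b) \<Rightarrow> 'b set \<Rightarrow> 'c set \<Rightarrow> bool" where
  "inverse_maps f g D E \<longleftrightarrow>
     f ` D \<subseteq> E \<and> g ` E \<subseteq> D \<and> (\<forall>x\<in>D. g (f x) = x) \<and> (\<forall>y\<in>E. f (g y) = y)"

definition conv_inverse ::
  "'a bracket \<Rightarrow>
     (nat \<Rightarrow> real) \<Rightarrow> (nat \<Rightarrow> real) \<Rightarrow> 'a endo set \<Rightarrow> 'a endo set \<Rightarrow> bool" where
  "conv_inverse B c b P Q \<longleftrightarrow>
     P \<subseteq> conv_domain B c \<and> Q \<subseteq> conv_domain B b \<and>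
     inverse_maps (conv_series B c) (conv_series B b) P Q"

definition endos_at :: "real set \<Rightarrow> 'a endo set" where
  "endos_at U = {X. linear X \<and> (\<exists>t\<in>U. X (of_word []) = t *\<^sub>R of_word [])}"

end

theory Submission
  imports Defs
begin

text \<open>The words \<open>x\<close> in the right tensor factor keep track of the factorizations, so a power of
  \<open>word_sum g\<close> is \<open>word_sum\<close> of the convolution power of \<open>g\<close>; this turns power series of tensors
  into convolution power series. For the compositional inverse, write an endomorphism with
  \<open>X(1) = t 1\<close> as \<open>t \<nu> + X\<^sub>0\<close>. Since \<open>X\<^sub>0\<close> kills the empty word, its \<open>m\<close>-th convolution power
  kills words shorter than \<open>m\<close>, so formal power series can be evaluated at \<open>X\<^sub>0\<close>. As the
  quasi-shuffle product is associative, this evaluation is a homomorphism, and \<open>X\<close> is the image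
  of \<open>t + x\<close>. It remains to compose series of numbers: for convergent series the re-expansion
  around \<open>t\<close> is justified by absolute summability of the double series.\<close>

section \<open>Associativity of the quasi-shuffle product\<close>

lemma lookup_scaleR [simp]: "Poly_Mapping.lookup (r *\<^sub>R p) i = r *\<^sub>R Poly_Mapping.lookup p i"
proof -
  have "finite {i. r *\<^sub>R Poly_Mapping.lookup p i \<noteq> 0}"
    by (rule finite_subset[OF _ finite_keys[of p]]) (auto simp: in_keys_iff)
  then show ?thesis by (simp add: scaleR_poly_mapping_def)
qed

lemma lin_ext_superset:
  fixes g :: "'b \<Rightarrow> 'c::real_vector"
  assumes "finite A" "Poly_Mapping.keys p \<subseteq> A"
  shows "lin_ext g p = (\<Sum>w\<in>A. Poly_Mapping.lookup p w *\<^sub>R g w)"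
  unfolding lin_ext_def using assms
  by (intro sum.mono_neutral_left) (auto simp: in_keys_iff)

lemma linear_lin_ext:
  fixes g :: "'b \<Rightarrow> 'c::real_vector"
  shows "linear (lin_ext g)"
proof (rule linearI)
  fix p q :: "'b \<Rightarrow>\<^sub>0 real" and r :: real
  show "lin_ext g (p + q) = lin_ext g p + lin_ext g q"
    using Poly_Mapping.keys_add[of p q]
    by (simp add: lin_ext_superset[of "Poly_Mapping.keys p \<union> Poly_Mapping.keys q"]
        lookup_add scaleR_left_distrib sum.distrib)
  have "Poly_Mapping.keys (r *\<^sub>R p) \<subseteq> Poly_Mapping.keys p"
    by (auto simp: in_keys_iff)
  then show "lin_ext g (r *\<^sub>R p) = r *\<^sub>R lin_ext g p"
    by (simp add: lin_ext_superset[of "Poly_Mapping.keys p"] scaleR_sum_right)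
qed

lemma lin_ext_basis: "lin_ext (\<lambda>w. Poly_Mapping.single w 1) p = p"
  by (rule poly_mapping_eqI)
     (auto simp: lin_ext_def lookup_sum lookup_single when_def in_keys_iff if_distrib cong: if_cong)

lemma linear_eq_lin_ext:
  fixes F :: "('b \<Rightarrow>\<^sub>0 real) \<Rightarrow> 'c::real_vector"
  assumes "linear F"
  shows "F p = lin_ext (\<lambda>w. F (Poly_Mapping.single w 1)) p"
proof -
  have "F p = F (lin_ext (\<lambda>w. Poly_Mapping.single w 1) p)" by (simp add: lin_ext_basis)
  also have "\<dots> = lin_ext (\<lambda>w. F (Poly_Mapping.single w 1)) p"
    using assms by (simp add: lin_ext_def linear_sum linear_scale)
  finally show ?thesis .
qed

lemma linear_eq_on_basis:
  fixes F G :: "('b \<Rightarrow>\<^sub>0 real) \<Rightarrow> 'c::real_vector"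
  assumes "linear F" "linear G"
    and "\<And>w. F (Poly_Mapping.single w 1) = G (Poly_Mapping.single w 1)"
  shows "F p = G p"
  using assms by (simp add: linear_eq_lin_ext[of F p] linear_eq_lin_ext[of G p])

lemma linear_lin_ext_param:
  assumes "\<And>w. linear (\<lambda>x. F x w)"
  shows "linear (\<lambda>x. lin_ext (F x) p)"
  unfolding lin_ext_def
  by (intro linear_compose_sum ballI linear_compose_scale_right assms)

lemma bilinear_lin_ext: "bilinear (\<lambda>p q. lin_ext (\<lambda>u. lin_ext (g u) q) p)"
  unfolding bilinear_def by (intro allI conjI linear_lin_ext_param linear_lin_ext)

lemma bilinear_qsh_prod: "bilinear (qsh_prod B)"
  unfolding qsh_prod_def[abs_def] by (rule bilinear_lin_ext)

lemma bilinear_concat_prod: "bilinear concat_prod"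
  unfolding concat_prod_def[abs_def] by (rule bilinear_lin_ext)

lemma qsh_prod_of_word [simp]: "qsh_prod B (of_word u) (of_word v) = qsh B u v"
  by (simp add: qsh_prod_def)

lemma linear_qsh_prod_left: "linear (\<lambda>p. qsh_prod B p q)"
  and linear_qsh_prod_right: "linear (qsh_prod B p)"
  using bilinear_qsh_prod[of B] by (auto simp: bilinear_def)

lemma qsh_prod_Nil_left [simp]: "qsh_prod B (of_word []) p = p"
  by (rule linear_eq_on_basis) (auto simp: qsh_Nil linear_qsh_prod_right linear_id[unfolded id_def])

lemma qsh_prod_Nil_right [simp]: "qsh_prod B p (of_word []) = p"
  by (rule linear_eq_on_basis) (auto simp: qsh_Nil linear_qsh_prod_left linear_id[unfolded id_def])

definition append_letter :: "'a words \<Rightarrow> ('a \<Rightarrow>\<^sub>0 real) \<Rightarrow> 'a words" where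
  "append_letter p \<alpha> = concat_prod p (of_letters \<alpha>)"

lemma append_letter_of_word: "append_letter (of_word u) (Poly_Mapping.single a 1) = of_word (u @ [a])"
  by (simp add: append_letter_def concat_prod_def of_letters_def)

lemma linear_of_letters: "linear of_letters"
  unfolding of_letters_def by (rule linear_lin_ext)

lemma linear_append_letter_left: "linear (\<lambda>p. append_letter p \<alpha>)"
  using bilinear_concat_prod unfolding append_letter_def bilinear_def by blast

lemma linear_append_letter_right: "linear (append_letter p)"
  using bilinear_concat_prod linear_compose[OF linear_of_letters, of "concat_prod p"]
  unfolding append_letter_def[abs_def] bilinear_def o_def by blast

lemmas linear_intros =
  linear_compose_add
  linear_compose[OF _ linear_append_letter_left, unfolded o_def]
  linear_compose[OF _ linear_append_letter_right, unfolded o_def]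
  linear_compose[OF _ linear_qsh_prod_left, unfolded o_def]
  linear_compose[OF _ linear_qsh_prod_right, unfolded o_def]
  linear_id[unfolded id_def]

lemma qsh_prod_append_letter:
  assumes "bilinear B"
  shows "qsh_prod B (append_letter p \<alpha>) (append_letter q \<beta>) =
      append_letter (qsh_prod B p (append_letter q \<beta>)) \<alpha>
    + append_letter (qsh_prod B (append_letter p \<alpha>) q) \<beta>
    + append_letter (qsh_prod B p q) (B \<alpha> \<beta>)"
proof -
  have B: "linear (\<lambda>x. B x y)" "linear (B y)" for y using assms by (auto simp: bilinear_def)
  note lin = linear_intros linear_compose[OF B(1) linear_append_letter_right, unfolded o_def]
     linear_compose[OF B(2) linear_append_letter_right, unfolded o_def]
  let ?P = "\<lambda>p \<alpha> q \<beta>. qsh_prod B (append_letter p \<alpha>) (append_letter q \<beta>) =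
      append_letter (qsh_prod B p (append_letter q \<beta>)) \<alpha>
    + append_letter (qsh_prod B (append_letter p \<alpha>) q) \<beta>
    + append_letter (qsh_prod B p q) (B \<alpha> \<beta>)"
  have 1: "?P (of_word u) (Poly_Mapping.single a 1) (of_word v) (Poly_Mapping.single b 1)" for u v a b
    unfolding append_letter_of_word qsh_prod_of_word qsh_snoc
    by (simp add: append_letter_def of_letters_def)
  have 2: "?P (of_word u) (Poly_Mapping.single a 1) (of_word v) \<beta>" for u v a \<beta>
    by (rule linear_eq_on_basis[where p = \<beta>]) (intro lin 1)+
  have 3: "?P (of_word u) \<alpha> (of_word v) \<beta>" for u v \<alpha> \<beta>
    by (rule linear_eq_on_basis[where p = \<alpha>]) (intro lin 2)+
  have 4: "?P (of_word u) \<alpha> q \<beta>" for u \<alpha> q \<beta>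
    by (rule linear_eq_on_basis[where p = q]) (intro lin 3)+
  show ?thesis
    by (rule linear_eq_on_basis[where p = p]) (intro lin 4)+
qed

lemma qsh_assoc:
  assumes "bilinear B" and assoc: "\<And>x y z. B (B x y) z = B x (B y z)"
  shows "qsh_prod B (qsh B u v) (of_word w) = qsh_prod B (of_word u) (qsh B v w)"
proof (induction "length u + length v + length w" arbitrary: u v w rule: less_induct)
  case less
  show ?case
  proof (cases "u = [] \<or> v = [] \<or> w = []")
    case True
    then show ?thesis by (auto simp: qsh_Nil)
  next
    case False
    then obtain u' a v' b w' c where uvw: "u = u' @ [a]" "v = v' @ [b]" "w = w' @ [c]"
      by (metis rev_exhaust)
    define \<alpha> \<beta> \<gamma> where "\<alpha> = Poly_Mapping.single a (1::real)" "\<beta> = Poly_Mapping.single b (1::real)"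
      "\<gamma> = Poly_Mapping.single c (1::real)"
    define p q r where "p = of_word u'" "q = of_word v'" "r = of_word w'"
    let ?mul = "qsh_prod B"
    let ?app = append_letter
    note defs = \<alpha>_\<beta>_\<gamma>_def p_q_r_def
    have words: "of_word u = ?app p \<alpha>" "of_word v = ?app q \<beta>" "of_word w = ?app r \<gamma>"
      by (simp_all add: defs append_letter_of_word uvw)
    have IH: "?mul (?mul (of_word x) (of_word y)) (of_word z) = ?mul (of_word x) (?mul (of_word y) (of_word z))"
      if "length x + length y + length z < length u + length v + length w" for x y z
      using less[OF that] by simp
    note IHs = IH[of u' v' w'] IH[of u v' w'] IH[of u' v w'] IH[of u' v' w]
       IH[of u v w'] IH[of u v' w] IH[of u' v w]
    note IHs' = IHs[unfolded words, folded p_q_r_def, unfolded uvw, simplified]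
    note mul = qsh_prod_append_letter[OF \<open>bilinear B\<close>]
    note dist = bilinear_ladd[OF bilinear_qsh_prod] bilinear_radd[OF bilinear_qsh_prod]
      linear_add[OF linear_append_letter_left]
    have "?mul (?mul (?app p \<alpha>) (?app q \<beta>)) (?app r \<gamma>) =
       ?app (?mul (?mul p (?app q \<beta>)) (?app r \<gamma>)) \<alpha>
     + ?app (?mul (?mul (?app p \<alpha>) q) (?app r \<gamma>)) \<beta>
     + ?app (?mul (?mul p q) (?app r \<gamma>)) (B \<alpha> \<beta>)
     + ?app (?mul (?mul p (?app q \<beta>)) r) (B \<alpha> \<gamma>)
     + ?app (?mul (?mul (?app p \<alpha>) q) r) (B \<beta> \<gamma>)
     + ?app (?mul (?mul p q) r) (B (B \<alpha> \<beta>) \<gamma>)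
     + ?app (?mul (?mul (?app p \<alpha>) (?app q \<beta>)) r) \<gamma>"
      unfolding mul[of p \<alpha> q \<beta>] dist mul[of _ _ r \<gamma>] by (simp add: add_ac)
    moreover have "?mul (?app p \<alpha>) (?mul (?app q \<beta>) (?app r \<gamma>)) =
       ?app (?mul p (?mul (?app q \<beta>) (?app r \<gamma>))) \<alpha>
     + ?app (?mul (?app p \<alpha>) (?mul q (?app r \<gamma>))) \<beta>
     + ?app (?mul p (?mul q (?app r \<gamma>))) (B \<alpha> \<beta>)
     + ?app (?mul p (?mul (?app q \<beta>) r)) (B \<alpha> \<gamma>)
     + ?app (?mul (?app p \<alpha>) (?mul q r)) (B \<beta> \<gamma>)
     + ?app (?mul p (?mul q r)) (B \<alpha> (B \<beta> \<gamma>))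
     + ?app (?mul (?app p \<alpha>) (?mul (?app q \<beta>) r)) \<gamma>"
      unfolding mul[of q \<beta> r \<gamma>] dist mul[of p \<alpha>] by (simp add: add_ac)
    ultimately have "?mul (?mul (?app p \<alpha>) (?app q \<beta>)) (?app r \<gamma>) = ?mul (?app p \<alpha>) (?mul (?app q \<beta>) (?app r \<gamma>))"
      by (simp only: IHs' assoc)
    then show ?thesis by (simp flip: words)
  qed
qed

lemma qsh_prod_assoc:
  assumes "bilinear B" and "\<And>x y z. B (B x y) z = B x (B y z)"
  shows "qsh_prod B (qsh_prod B p q) r = qsh_prod B p (qsh_prod B q r)"
proof -
  have 1: "qsh_prod B (qsh_prod B (of_word u) (of_word v)) (of_word w)
      = qsh_prod B (of_word u) (qsh_prod B (of_word v) (of_word w))" for u v w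
    using qsh_assoc[OF assms] by simp
  have 2: "qsh_prod B (qsh_prod B (of_word u) (of_word v)) r
      = qsh_prod B (of_word u) (qsh_prod B (of_word v) r)" for u v r
    by (rule linear_eq_on_basis[where p = r]) (intro linear_intros 1)+
  have 3: "qsh_prod B (qsh_prod B (of_word u) q) r
      = qsh_prod B (of_word u) (qsh_prod B q r)" for u q r
    by (rule linear_eq_on_basis[where p = q]) (intro linear_intros 2)+
  show ?thesis
    by (rule linear_eq_on_basis[where p = p]) (intro linear_intros 3)+
qed

section \<open>Composition of power series of numbers\<close>

definition fps_sums :: "(nat \<Rightarrow> real) \<Rightarrow> real fps \<Rightarrow> real fps \<Rightarrow> bool" where
  "fps_sums c \<phi> \<psi> \<longleftrightarrow> (\<forall>m. (\<lambda>k. c k * fps_nth (\<phi> ^ k) m) sums fps_nth \<psi> m)"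



abbreviation fps_norm :: "real fps \<Rightarrow> real fps" where
  "fps_norm \<phi> \<equiv> Abs_fps (\<lambda>n. norm (fps_nth \<phi> n))"

lemma fps_conv_radius_abs [simp]:
  "fps_conv_radius (Abs_fps (\<lambda>n. \<bar>fps_nth \<phi> n\<bar>)) = fps_conv_radius (\<phi> :: real fps)"
  using fps_conv_radius_norm[of \<phi>] by simp

lemma norm_fps_nth_power_le:
  "norm (fps_nth (\<phi> ^ k) m) \<le> fps_nth (fps_norm \<phi> ^ k) m" 
proof (induction k arbitrary: m)
  case (Suc k)
  have "norm (fps_nth (\<phi> ^ Suc k) m) \<le> (\<Sum>i=0..m. norm (fps_nth \<phi> i) * norm (fps_nth (\<phi> ^ k) (m - i)))"
    by (auto simp: fps_mult_nth abs_mult intro!: order.trans[OF sum_abs])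
  also have "\<dots> \<le> fps_nth (fps_norm \<phi> ^ Suc k) m"
    using Suc by (auto simp: fps_mult_nth intro!: sum_mono mult_left_mono)
  finally show ?case .
qed simp

lemma has_sum_eval_fps_power:
  fixes \<phi> :: "real fps"
  assumes "ereal (norm h) < fps_conv_radius \<phi>"
  shows "((\<lambda>m. fps_nth (\<phi> ^ k) m * h ^ m) has_sum eval_fps \<phi> h ^ k) UNIV"
proof -
  have r: "ereal (norm h) < fps_conv_radius (\<phi> ^ k)"
    using assms fps_conv_radius_power[of \<phi> k] by (rule less_le_trans)
  have "(\<lambda>m. fps_nth (\<phi> ^ k) m * h ^ m) sums eval_fps \<phi> h ^ k"
    using sums_eval_fps[OF r] eval_fps_power[OF assms, of k] by simp
  then show ?thesis by (intro norm_summable_imp_has_sum norm_summable_fps[OF r])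
qed

lemma fps_sums_eval_fps:
  fixes \<phi> :: "real fps"
  assumes r: "0 < r" "ereal r < fps_conv_radius \<phi>"
    and c: "summable (\<lambda>k. norm (c k * eval_fps (fps_norm \<phi>) r ^ k))"
  obtains \<psi> where "fps_sums c \<phi> \<psi>"
    "\<And>h. norm h \<le> r \<Longrightarrow> (\<lambda>m. fps_nth \<psi> m * h ^ m) sums suminf (\<lambda>k. c k * eval_fps \<phi> h ^ k)"
proof -
  let ?F = "\<lambda>h (k, m). c k * (fps_nth (\<phi> ^ k) m * h ^ m)"
  let ?M = "eval_fps (fps_norm \<phi>) r"
  have M: "0 \<le> ?M"
    unfolding eval_fps_def using r
    by (intro suminf_nonneg summable_fps) auto
  have maj: "((\<lambda>m. fps_nth (fps_norm \<phi> ^ k) m * r ^ m) has_sum ?M ^ k) UNIV" for k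
    using r by (intro has_sum_eval_fps_power) simp
  have "(\<lambda>(k, m). norm (c k) * (fps_nth (fps_norm \<phi> ^ k) m * r ^ m)) summable_on UNIV \<times> UNIV"
  proof (rule summable_on_SigmaI)
    show "((\<lambda>m. case (k, m) of (k, m) \<Rightarrow> norm (c k) * (fps_nth (fps_norm \<phi> ^ k) m * r ^ m))
        has_sum norm (c k) * ?M ^ k) UNIV" for k
      using has_sum_cmult_right[OF maj] by simp
    show "(\<lambda>k. norm (c k) * ?M ^ k) summable_on UNIV"
      using c M by (subst summable_on_UNIV_nonneg_real_iff) (auto simp: abs_mult power_abs)
    show "0 \<le> (case (k, m) of (k, m) \<Rightarrow> norm (c k) * (fps_nth (fps_norm \<phi> ^ k) m * r ^ m))" for k m
      using norm_fps_nth_power_le[of \<phi> k m] r by simp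
  qed
  then have abs: "(\<lambda>x. norm (?F h x)) summable_on UNIV \<times> UNIV" if "norm h \<le> r" for h
  proof (rule Infinite_Sum.abs_summable_on_comparison_test', safe)
    fix k m
    have "norm (fps_nth (\<phi> ^ k) m * h ^ m) \<le> fps_nth (fps_norm \<phi> ^ k) m * r ^ m"
      using that norm_fps_nth_power_le[of \<phi> k m] r
      by (auto simp: abs_mult power_abs intro!: mult_mono power_mono)
    then show "norm (c k * (fps_nth (\<phi> ^ k) m * h ^ m)) \<le> norm (c k) * (fps_nth (fps_norm \<phi> ^ k) m * r ^ m)"
      by (simp add: abs_mult mult_left_mono)
  qed
  have F: "?F h summable_on UNIV \<times> UNIV" if "norm h \<le> r" for h
    using abs[OF that] by (rule abs_summable_summable)
  have F': "(\<lambda>(m, k). c k * (fps_nth (\<phi> ^ k) m * h ^ m)) summable_on UNIV \<times> UNIV" if "norm h \<le> r" for h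
    using F[OF that] by (subst (asm) summable_on_swap) simp
  have col: "(\<lambda>k. c k * fps_nth (\<phi> ^ k) m) summable_on UNIV" for m
  proof -
    have "(\<lambda>k. c k * (fps_nth (\<phi> ^ k) m * r ^ m)) summable_on UNIV"
      using summable_on_SigmaD1[OF F'[of r], of m] r by simp
    then have "(\<lambda>k. c k * fps_nth (\<phi> ^ k) m * r ^ m) summable_on UNIV" by (simp add: mult.assoc)
    then show ?thesis using r by (subst (asm) summable_on_cmult_left') auto
  qed
  define \<psi> where "\<psi> = Abs_fps (\<lambda>m. \<Sum>\<^sub>\<infinity>k. c k * fps_nth (\<phi> ^ k) m)"
  have \<psi>: "((\<lambda>k. c k * fps_nth (\<phi> ^ k) m) has_sum fps_nth \<psi> m) UNIV" for m
    using col by (simp add: \<psi>_def)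
  show ?thesis
  proof
    show "fps_sums c \<phi> \<psi>"
      using \<psi> by (auto simp: fps_sums_def intro: has_sum_imp_sums)
    fix h :: real assume h: "norm h \<le> r"
    from F[OF h] obtain S where S: "(?F h has_sum S) (UNIV \<times> UNIV)" by (auto simp: summable_on_def)
    have "ereal (norm h) < fps_conv_radius \<phi>"
      using h r by (meson ereal_less_eq(3) le_less_trans)
    then have "((\<lambda>k. c k * eval_fps \<phi> h ^ k) has_sum S) UNIV"
      by (intro has_sum_SigmaD[OF S]) (auto intro!: has_sum_cmult_right has_sum_eval_fps_power)
    then have "suminf (\<lambda>k. c k * eval_fps \<phi> h ^ k) = S"
      by (intro sums_unique[symmetric] has_sum_imp_sums)
    moreover have "((\<lambda>m. fps_nth \<psi> m * h ^ m) has_sum S) UNIV"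
    proof (rule has_sum_SigmaD)
      show "((\<lambda>(m, k). c k * (fps_nth (\<phi> ^ k) m * h ^ m)) has_sum S) (UNIV \<times> UNIV)"
        using S by (subst (asm) has_sum_swap) simp
      show "((\<lambda>k. case (m, k) of (m, k) \<Rightarrow> c k * (fps_nth (\<phi> ^ k) m * h ^ m)) has_sum fps_nth \<psi> m * h ^ m) UNIV" for m
        using has_sum_cmult_left[OF \<psi>[of m], of "h ^ m"] by (simp add: mult.assoc)
    qed
    ultimately show "(\<lambda>m. fps_nth \<psi> m * h ^ m) sums suminf (\<lambda>k. c k * eval_fps \<phi> h ^ k)"
      by (simp add: has_sum_imp_sums)
  qed
qed

lemma powser_eq_0:
  fixes a :: "nat \<Rightarrow> real"
  assumes "0 < s" and "\<And>x. norm x < s \<Longrightarrow> (\<lambda>n. a n * x ^ n) sums 0"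
  shows "a n = 0"
proof (induction n rule: less_induct)
  case (less n)
  have "(\<lambda>m. a (m + n) * x ^ m) sums 0" if "x \<noteq> 0" "norm x < s" for x
  proof -
    have "(\<lambda>m. a (m + n) * x ^ (m + n)) sums 0"
      using sums_iff_shift[of "\<lambda>n. a n * x ^ n" n 0] assms(2)[OF that(2)] less by simp
    then have "(\<lambda>m. x ^ n * (a (m + n) * x ^ m)) sums (x ^ n * 0)"
      by (simp add: power_add mult_ac)
    then show ?thesis using that(1) by (subst (asm) sums_mult_iff) auto
  qed
  from powser_limit_0_strong[OF \<open>0 < s\<close> this] have "((\<lambda>_. 0) \<longlongrightarrow> a n) (at (0::real))" by simp
  then show ?case using tendsto_unique[OF _ tendsto_const] trivial_limit_at by metis
qed

lemma less_conv_radius_open: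
  fixes c :: "nat \<Rightarrow> real"
  assumes "open U" "\<And>t. t \<in> U \<Longrightarrow> summable (\<lambda>k. c k * t ^ k)" "t \<in> U"
  shows "ereal (norm t) < conv_radius c"
proof -
  obtain e where e: "0 < e" "ball t e \<subseteq> U" using assms(1,3) openE by blast
  define x where "x = (if t \<ge> 0 then t + e / 2 else t - e / 2)"
  have "x \<in> U" using e by (auto simp: x_def dist_real_def intro!: subsetD[OF e(2)])
  then have "norm x \<le> conv_radius c" using assms(2) by (intro conv_radius_geI)
  moreover have "norm t < norm x" using e(1) by (auto simp: x_def)
  ultimately show ?thesis by (meson ereal_less(2) less_le_trans less_ereal.simps(1))
qed

lemma fps_sums_inverse:
  fixes b c :: "nat \<Rightarrow> real"
  defines "f \<equiv> \<lambda>t. suminf (\<lambda>k. c k * t ^ k)" and "g \<equiv> \<lambda>s. suminf (\<lambda>k. b k * s ^ k)"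
  assumes U: "open U" "\<And>t. t \<in> U \<Longrightarrow> summable (\<lambda>k. c k * t ^ k)"
    and V: "open V" "\<And>s. s \<in> V \<Longrightarrow> summable (\<lambda>k. b k * s ^ k)"
    and fU: "f ` U \<subseteq> V" and gf: "\<And>t. t \<in> U \<Longrightarrow> g (f t) = t"
    and t: "t \<in> U"
  shows "\<exists>\<psi>. fps_nth \<psi> 0 \<in> V \<and> fps_sums c (fps_const t + fps_X) \<psi> \<and> fps_sums b \<psi> (fps_const t + fps_X)"
proof -
  define \<phi> where "\<phi> = fps_const t + fps_X"
  have rad: "fps_conv_radius \<phi> = \<infinity>"
    using fps_conv_radius_add[of "fps_const t" fps_X] by (simp add: \<phi>_def)
  have eval_\<phi>: "eval_fps \<phi> h = t + h" for h by (simp add: \<phi>_def eval_fps_add)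
  have "fps_norm \<phi> = fps_const (norm t) + fps_X"
    by (rule fps_ext) (auto simp: \<phi>_def fps_X_def)
  then have eval_norm: "eval_fps (fps_norm \<phi>) h = norm t + h" for h by (simp add: eval_fps_add)
  obtain R where R: "norm t < R" "ereal R < conv_radius c"
    using ereal_dense2[OF less_conv_radius_open[OF U t]] by auto
  define r where "r = R - norm t"
  have "0 < r" using R by (simp add: r_def)
  moreover have "summable (\<lambda>k. norm (c k * eval_fps (fps_norm \<phi>) r ^ k))"
    unfolding eval_norm using R by (intro abs_summable_in_conv_radius) (auto simp: r_def)
  ultimately obtain \<psi> where \<psi>: "fps_sums c \<phi> \<psi>"
    and sums_\<psi>: "\<And>h. norm h \<le> r \<Longrightarrow> (\<lambda>m. fps_nth \<psi> m * h ^ m) sums f (t + h)"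
    using fps_sums_eval_fps[of r \<phi> c] by (auto simp: rad eval_\<phi> f_def)
  have eval_\<psi>: "eval_fps \<psi> h = f (t + h)" if "norm h \<le> r" for h
    unfolding eval_fps_def using sums_\<psi>[OF that] by (rule sums_unique[symmetric])
  have \<psi>0: "fps_nth \<psi> 0 = f t" using eval_\<psi>[of 0] \<open>0 < r\<close> by (simp add: eval_fps_at_0)
  then have \<psi>V: "fps_nth \<psi> 0 \<in> V" using fU t by auto
  have "norm r \<le> fps_conv_radius \<psi>"
    unfolding fps_conv_radius_def using sums_\<psi>[of r] \<open>0 < r\<close>
    by (intro conv_radius_geI) (auto intro: sums_summable)
  then have rad\<psi>: "ereal r \<le> fps_conv_radius \<psi>" using \<open>0 < r\<close> by simp
  obtain K where K: "norm (fps_nth \<psi> 0) < K" "ereal K < conv_radius b"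
    using ereal_dense2[OF less_conv_radius_open[OF V \<psi>V]] by auto
  have "isCont (eval_fps (fps_norm \<psi>)) 0"
    using rad\<psi> \<open>0 < r\<close> by (intro continuous_eval_fps) (auto intro: less_le_trans[of _ "ereal r"])
  moreover have "eval_fps (fps_norm \<psi>) 0 < K" using K by (simp add: eval_fps_at_0)
  ultimately have "eventually (\<lambda>h. eval_fps (fps_norm \<psi>) h < K) (at 0)"
    by (simp add: isCont_def order_tendstoD(2))
  then obtain d where d: "0 < d" "\<And>h. h \<noteq> 0 \<Longrightarrow> norm h < d \<Longrightarrow> eval_fps (fps_norm \<psi>) h < K"
    by (auto simp: eventually_at dist_real_def)
  obtain e where e: "0 < e" "ball t e \<subseteq> U" using U(1) t openE by blast
  define \<rho> where "\<rho> = min (r / 2) (min (d / 2) (e / 2))"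
  have \<rho>: "0 < \<rho>" "\<rho> < r" "\<rho> < d" "\<rho> < e" using \<open>0 < r\<close> d(1) e(1) by (auto simp: \<rho>_def)
  have \<rho>_rad: "ereal \<rho> < fps_conv_radius \<psi>"
    using \<rho>(2) rad\<psi> by (meson less_ereal.simps(1) less_le_trans)
  have "0 \<le> eval_fps (fps_norm \<psi>) \<rho>"
    unfolding eval_fps_def using \<rho> \<rho>_rad by (intro suminf_nonneg summable_fps) auto
  moreover have "eval_fps (fps_norm \<psi>) \<rho> < K" using d(2)[of \<rho>] \<rho> by simp
  ultimately have "ereal (norm (eval_fps (fps_norm \<psi>) \<rho>)) < conv_radius b"
    using K(2) by (metis abs_of_nonneg less_ereal.simps(1) less_trans real_norm_def)
  then have "summable (\<lambda>k. norm (b k * eval_fps (fps_norm \<psi>) \<rho> ^ k))"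
    by (rule abs_summable_in_conv_radius)
  then obtain \<xi> where \<xi>: "fps_sums b \<psi> \<xi>"
    and sums_\<xi>: "\<And>h. norm h \<le> \<rho> \<Longrightarrow> (\<lambda>m. fps_nth \<xi> m * h ^ m) sums g (eval_fps \<psi> h)"
    using fps_sums_eval_fps[OF \<rho>(1) \<rho>_rad, of b] unfolding g_def by blast
  have "(\<lambda>m. fps_nth (\<xi> - \<phi>) m * h ^ m) sums 0" if h: "norm h < \<rho>" for h
  proof -
    have "t + h \<in> U" using h \<rho> by (intro subsetD[OF e(2)]) (auto simp: dist_real_def)
    then have \<xi>: "(\<lambda>m. fps_nth \<xi> m * h ^ m) sums (t + h)"
      using sums_\<xi>[of h] eval_\<psi>[of h] h \<rho> by (simp add: gf)
    have \<phi>: "(\<lambda>m. fps_nth \<phi> m * h ^ m) sums (t + h)"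
      using sums_eval_fps[of h \<phi>] by (simp add: rad eval_\<phi>)
    show ?thesis using sums_diff[OF \<xi> \<phi>] by (simp add: left_diff_distrib)
  qed
  then have "fps_nth (\<xi> - \<phi>) m = 0" for m by (rule powser_eq_0[OF \<rho>(1)])
  then have "\<xi> = \<phi>" by (simp add: fps_eq_iff)
  then show ?thesis using \<psi> \<psi>V \<xi> by (auto simp: \<phi>_def)
qed

lemma fps_sums_compose:
  assumes "fps_nth \<phi> 0 = 0"
  shows "fps_sums c \<phi> (Abs_fps c oo \<phi>)"
  unfolding fps_sums_def
proof
  fix m
  have "(\<lambda>k. c k * fps_nth (\<phi> ^ k) m) sums (\<Sum>k\<in>{0..m}. c k * fps_nth (\<phi> ^ k) m)"
    using assms by (intro sums_finite) (auto simp: startsby_zero_power_prefix)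
  then show "(\<lambda>k. c k * fps_nth (\<phi> ^ k) m) sums fps_nth (Abs_fps c oo \<phi>) m"
    by (simp add: fps_compose_nth)
qed

section \<open>The convolution algebra\<close>

definition fun_conv :: "'a bracket \<Rightarrow> ('a list \<Rightarrow> 'a words) \<Rightarrow> ('a list \<Rightarrow> 'a words) \<Rightarrow> 'a list \<Rightarrow> 'a words" where
  "fun_conv B g h w = (\<Sum>(u, v)\<in>{(u, v). u @ v = w}. qsh_prod B (g u) (h v))"

definition fun_unit :: "'a list \<Rightarrow> 'a words" where
  "fun_unit w = (if w = [] then of_word [] else 0)"

primrec fun_power :: "'a bracket \<Rightarrow> ('a list \<Rightarrow> 'a words) \<Rightarrow> nat \<Rightarrow> 'a list \<Rightarrow> 'a words" where
  "fun_power B g 0 = fun_unit"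
| "fun_power B g (Suc k) = fun_conv B g (fun_power B g k)"

lemma conv_power_of_word: "conv_power B X k (of_word w) = fun_power B (\<lambda>w. X (of_word w)) k w"
proof (induction k arbitrary: w)
  case 0
  show ?case by (simp add: conv_unit_def fun_unit_def)
next
  case (Suc k)
  then show ?case by (simp add: convolution_def fun_conv_def)
qed

lemma linear_conv_power: "linear (conv_power B X k)"
  by (cases k) (simp_all add: conv_unit_def convolution_def linear_lin_ext)

lemma fun_conv_assoc:
  assumes "bilinear B" and "\<And>x y z. B (B x y) z = B x (B y z)"
  shows "fun_conv B (fun_conv B f g) h = fun_conv B f (fun_conv B g h)"
proof
  fix w
  have "fun_conv B (fun_conv B f g) h w =
     (\<Sum>t\<in>{(x, z). x @ z = w}. \<Sum>s\<in>{(u, v). u @ v = fst t}.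
        qsh_prod B (qsh_prod B (f (fst s)) (g (snd s))) (h (snd t)))"
    unfolding fun_conv_def case_prod_beta by (simp add: linear_sum[OF linear_qsh_prod_left])
  also have "\<dots> = (\<Sum>(t, s)\<in>(SIGMA t:{(x, z). x @ z = w}. {(u, v). u @ v = fst t}).
        qsh_prod B (f (fst s)) (qsh_prod B (g (snd s)) (h (snd t))))"
    by (simp add: sum.Sigma finite_factorizations qsh_prod_assoc[OF assms])
  also have "\<dots> = (\<Sum>(t, s)\<in>(SIGMA t:{(u, y). u @ y = w}. {(v, z). v @ z = snd t}).
        qsh_prod B (f (fst t)) (qsh_prod B (g (fst s)) (h (snd s))))"
    by (rule sum.reindex_bij_witness[where
          i = "\<lambda>((u, y), (v, z)). ((u @ v, z), (u, v))" and
          j = "\<lambda>((x, z), (u, v)). ((u, v @ z), (v, z))"]) auto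
  also have "\<dots> = (\<Sum>t\<in>{(u, y). u @ y = w}. \<Sum>s\<in>{(v, z). v @ z = snd t}.
        qsh_prod B (f (fst t)) (qsh_prod B (g (fst s)) (h (snd s))))"
    by (simp add: sum.Sigma finite_factorizations)
  also have "\<dots> = fun_conv B f (fun_conv B g h) w"
    unfolding fun_conv_def case_prod_beta by (simp add: linear_sum[OF linear_qsh_prod_right])
  finally show "fun_conv B (fun_conv B f g) h w = fun_conv B f (fun_conv B g h) w" .
qed

lemma fun_conv_unit_left: "fun_conv B fun_unit g = g"
proof
  fix w
  have "fun_conv B fun_unit g w = (\<Sum>t\<in>{(u, v). u @ v = w}. if t = ([], w) then g w else 0)"
    unfolding fun_conv_def
    by (intro sum.cong refl)
       (auto simp: fun_unit_def linear_0[OF linear_qsh_prod_left] split: if_splits)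
  then show "fun_conv B fun_unit g w = g w"
    by (simp add: sum.delta finite_factorizations)
qed

lemma fun_power_add:
  assumes "bilinear B" and "\<And>x y z. B (B x y) z = B x (B y z)"
  shows "fun_conv B (fun_power B g i) (fun_power B g j) = fun_power B g (i + j)"
  by (induction i) (simp_all add: fun_conv_unit_left fun_conv_assoc[OF assms])

lemma fun_power_eq_0:
  assumes "g [] = 0" "length w < k"
  shows "fun_power B g k w = 0"
  using assms(2)
proof (induction k arbitrary: w)
  case (Suc k)
  have "qsh_prod B (g u) (fun_power B g k v) = 0" if "u @ v = w" for u v
  proof (cases "u = []")
    case True
    then show ?thesis by (simp add: assms(1) linear_0[OF linear_qsh_prod_left])
  next
    case False
    then have "length v < k" using that Suc.prems by (cases u) auto
    then show ?thesis by (simp add: Suc.IH linear_0[OF linear_qsh_prod_right])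
  qed
  then show ?case by (auto simp: fun_conv_def intro!: sum.neutral)
qed simp

text \<open>If \<open>g []\<close> vanishes, this is evaluation of \<open>\<phi>\<close> at \<open>g\<close>: the omitted powers are zero at \<open>w\<close>.\<close>

definition fps_fun :: "'a bracket \<Rightarrow> ('a list \<Rightarrow> 'a words) \<Rightarrow> real fps \<Rightarrow> 'a list \<Rightarrow> 'a words" where
  "fps_fun B g \<phi> w = (\<Sum>m\<le>length w. fps_nth \<phi> m *\<^sub>R fun_power B g m w)"

lemma fps_fun_atMost:
  assumes "g [] = 0" "length w \<le> N"
  shows "fps_fun B g \<phi> w = (\<Sum>m\<le>N. fps_nth \<phi> m *\<^sub>R fun_power B g m w)"
  unfolding fps_fun_def using assms by (intro sum.mono_neutral_left) (auto simp: fun_power_eq_0)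

lemma fun_conv_sum_scaleR:
  assumes "finite I" "finite J"
  shows "fun_conv B (\<lambda>w. \<Sum>i\<in>I. a i *\<^sub>R G i w) (\<lambda>w. \<Sum>j\<in>J. b j *\<^sub>R H j w) w
    = (\<Sum>i\<in>I. \<Sum>j\<in>J. (a i * b j) *\<^sub>R fun_conv B (G i) (H j) w)"
proof -
  have "qsh_prod B (\<Sum>i\<in>I. a i *\<^sub>R p i) (\<Sum>j\<in>J. b j *\<^sub>R q j)
      = (\<Sum>i\<in>I. \<Sum>j\<in>J. (a i * b j) *\<^sub>R qsh_prod B (p i) (q j))" for p q
    unfolding linear_sum[OF linear_qsh_prod_left] linear_sum[OF linear_qsh_prod_right]
    by (subst sum.swap) (simp add: linear_scale[OF linear_qsh_prod_left] linear_scale[OF linear_qsh_prod_right] mult.commute)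
  then have "fun_conv B (\<lambda>w. \<Sum>i\<in>I. a i *\<^sub>R G i w) (\<lambda>w. \<Sum>j\<in>J. b j *\<^sub>R H j w) w
     = (\<Sum>t\<in>{(u, v). u @ v = w}. \<Sum>i\<in>I. \<Sum>j\<in>J. (a i * b j) *\<^sub>R qsh_prod B (G i (fst t)) (H j (snd t)))"
    by (simp add: fun_conv_def case_prod_beta)
  also have "\<dots> = (\<Sum>i\<in>I. \<Sum>j\<in>J. \<Sum>t\<in>{(u, v). u @ v = w}. (a i * b j) *\<^sub>R qsh_prod B (G i (fst t)) (H j (snd t)))"
    by (subst sum.swap, rule sum.cong[OF refl], rule sum.swap)
  finally show ?thesis by (simp add: fun_conv_def case_prod_beta scaleR_sum_right)
qed

lemma fps_fun_mult:
  fixes B :: "'a bracket" and g :: "'a list \<Rightarrow> 'a words"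
  assumes B: "bilinear B" "\<And>x y z. B (B x y) z = B x (B y z)" and g: "g [] = 0"
  shows "fun_conv B (fps_fun B g \<phi>) (fps_fun B g \<psi>) = fps_fun B g (\<phi> * \<psi>)"
proof
  fix w :: "'a list"
  let ?N = "length w"
  let ?P = "fun_power B g"
  have "fun_conv B (fps_fun B g \<phi>) (fps_fun B g \<psi>) w =
     fun_conv B (\<lambda>w. \<Sum>i\<le>?N. fps_nth \<phi> i *\<^sub>R ?P i w) (\<lambda>w. \<Sum>j\<le>?N. fps_nth \<psi> j *\<^sub>R ?P j w) w"
    unfolding fun_conv_def by (intro sum.cong refl) (auto simp: fps_fun_atMost[of g, OF g, of _ ?N])
  also have "\<dots> = (\<Sum>i\<le>?N. \<Sum>j\<le>?N. (fps_nth \<phi> i * fps_nth \<psi> j) *\<^sub>R ?P (i + j) w)"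
    by (simp add: fun_conv_sum_scaleR fun_power_add[OF B])
  also have "\<dots> = (\<Sum>(i, j)\<in>{..?N} \<times> {..?N}. (fps_nth \<phi> i * fps_nth \<psi> j) *\<^sub>R ?P (i + j) w)"
    by (simp add: sum.cartesian_product)
  also have "\<dots> = (\<Sum>(i, j)\<in>{(i, j). i + j \<le> ?N}. (fps_nth \<phi> i * fps_nth \<psi> j) *\<^sub>R ?P (i + j) w)"
    using fun_power_eq_0[of g, OF g] by (intro sum.mono_neutral_right) (auto simp flip: not_less)
  also have "\<dots> = (\<Sum>m\<le>?N. \<Sum>i\<le>m. (fps_nth \<phi> i * fps_nth \<psi> (m - i)) *\<^sub>R ?P (i + (m - i)) w)"
    by (rule sum.triangle_reindex_eq)
  also have "\<dots> = fps_fun B g (\<phi> * \<psi>) w"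
    by (simp add: fps_fun_def fps_mult_nth scaleR_sum_left atMost_atLeast0)
  finally show "fun_conv B (fps_fun B g \<phi>) (fps_fun B g \<psi>) w = fps_fun B g (\<phi> * \<psi>) w" .
qed

lemma fps_fun_1: "fps_fun B g 1 = fun_unit"
proof
  fix w
  have "fps_fun B g 1 w = (\<Sum>m\<le>length w. if m = 0 then fun_unit w else 0)"
    unfolding fps_fun_def by (intro sum.cong) auto
  then show "fps_fun B g 1 w = fun_unit w" by simp
qed

lemma fps_fun_power:
  fixes B :: "'a bracket" and g :: "'a list \<Rightarrow> 'a words"
  assumes "bilinear B" "\<And>x y z. B (B x y) z = B x (B y z)" and "g [] = 0"
  shows "fun_power B (fps_fun B g \<phi>) k = fps_fun B g (\<phi> ^ k)"
  by (induction k) (simp_all add: fps_fun_1 fps_fun_mult[of B g, OF assms])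

lemma fun_conv_unit_right: "fun_conv B g fun_unit = g"
proof
  fix w
  have "fun_conv B g fun_unit w = (\<Sum>t\<in>{(u, v). u @ v = w}. if t = (w, []) then g w else 0)"
    unfolding fun_conv_def
    by (intro sum.cong refl)
       (auto simp: fun_unit_def linear_0[OF linear_qsh_prod_right] split: if_splits)
  then show "fun_conv B g fun_unit w = g w"
    by (simp add: sum.delta finite_factorizations)
qed

lemma fps_fun_const_plus_X:
  assumes "g [] = t *\<^sub>R of_word []"
  shows "fps_fun B (\<lambda>w. g w - t *\<^sub>R fun_unit w) (fps_const t + fps_X) = g"
proof
  fix w
  let ?h = "\<lambda>w. g w - t *\<^sub>R fun_unit w"
  have "?h [] = 0" using assms by (simp add: fun_unit_def)
  then have "fps_fun B ?h (fps_const t + fps_X) w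
      = (\<Sum>m\<le>Suc (length w). fps_nth (fps_const t + fps_X) m *\<^sub>R fun_power B ?h m w)"
    by (rule fps_fun_atMost) simp
  also have "\<dots> = (\<Sum>m\<in>{0, 1}. fps_nth (fps_const t + fps_X) m *\<^sub>R fun_power B ?h m w)"
    by (intro sum.mono_neutral_right) auto
  also have "\<dots> = g w"
    by (simp add: fun_conv_unit_right)
  finally show "fps_fun B ?h (fps_const t + fps_X) w = g w" .
qed

section \<open>Convolution power series\<close>

lemma lookup_linear_words:
  fixes F :: "'a words \<Rightarrow> 'a words"
  assumes "linear F"
  shows "Poly_Mapping.lookup (F p) u
    = (\<Sum>w\<in>Poly_Mapping.keys p. Poly_Mapping.lookup p w * Poly_Mapping.lookup (F (of_word w)) u)"
  by (subst linear_eq_lin_ext[OF assms]) (simp add: lin_ext_def lookup_sum)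

lemma conv_sumsI:
  assumes "linear Y"
    and "\<And>w u. (\<lambda>k. c k * Poly_Mapping.lookup (fun_power B (\<lambda>w. X (of_word w)) k w) u)
      sums Poly_Mapping.lookup (Y (of_word w)) u"
  shows "conv_sums B c X Y"
  unfolding conv_sums_def
proof (intro allI)
  fix p u
  have "(\<lambda>k. \<Sum>w\<in>Poly_Mapping.keys p. Poly_Mapping.lookup p w
          * (c k * Poly_Mapping.lookup (fun_power B (\<lambda>w. X (of_word w)) k w) u))
      sums (\<Sum>w\<in>Poly_Mapping.keys p. Poly_Mapping.lookup p w * Poly_Mapping.lookup (Y (of_word w)) u)"
    by (intro sums_sum sums_mult assms(2))
  then show "(\<lambda>k. c k * Poly_Mapping.lookup (conv_power B X k p) u) sums Poly_Mapping.lookup (Y p) u"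
    by (simp add: lookup_linear_words[OF linear_conv_power, of _ _ _ p] conv_power_of_word
        lookup_linear_words[OF assms(1), of p] sum_distrib_left mult_ac)
qed

lemma linear_conv_sums:
  assumes "conv_sums B c X Y"
  shows "linear Y"
proof (rule linearI)
  have Y: "(\<lambda>k. c k * Poly_Mapping.lookup (conv_power B X k p) u) sums Poly_Mapping.lookup (Y p) u" for p u
    using assms by (simp add: conv_sums_def)
  note lin = linear_conv_power[of B X]
  fix p q r
  show "Y (p + q) = Y p + Y q"
  proof (rule poly_mapping_eqI)
    fix u
    show "Poly_Mapping.lookup (Y (p + q)) u = Poly_Mapping.lookup (Y p + Y q) u"
      using sums_unique2[OF Y[of "p + q" u]] sums_add[OF Y[of p u] Y[of q u]]
      by (simp add: linear_add[OF lin] lookup_add distrib_left)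
  qed
  show "Y (r *\<^sub>R p) = r *\<^sub>R Y p"
  proof (rule poly_mapping_eqI)
    fix u
    show "Poly_Mapping.lookup (Y (r *\<^sub>R p)) u = Poly_Mapping.lookup (r *\<^sub>R Y p) u"
      using sums_unique2[OF Y[of "r *\<^sub>R p" u]] sums_mult[OF Y[of p u], of r]
      by (simp add: linear_scale[OF lin] mult_ac)
  qed
qed

lemma pure_tensor_Nil: "pure_tensor (of_word []) (of_word []) = word_sum fun_unit"
  by (intro ext) (auto simp: pure_tensor_def word_sum_def fun_unit_def lookup_single when_def)

lemma lookup_qsh_prod:
  "Poly_Mapping.lookup (qsh_prod B p q) w
    = (\<Sum>\<^sub>\<infinity>(u, v). Poly_Mapping.lookup p u * Poly_Mapping.lookup q v * Poly_Mapping.lookup (qsh B u v) w)"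
proof -
  have "Poly_Mapping.lookup (qsh_prod B p q) w
     = (\<Sum>(u, v)\<in>Poly_Mapping.keys p \<times> Poly_Mapping.keys q.
         Poly_Mapping.lookup p u * Poly_Mapping.lookup q v * Poly_Mapping.lookup (qsh B u v) w)"
    by (simp add: qsh_prod_def lin_ext_def lookup_sum sum_distrib_left mult.assoc flip: sum.cartesian_product)
  also have "\<dots> = (\<Sum>\<^sub>\<infinity>(u, v)\<in>Poly_Mapping.keys p \<times> Poly_Mapping.keys q.
         Poly_Mapping.lookup p u * Poly_Mapping.lookup q v * Poly_Mapping.lookup (qsh B u v) w)"
    by simp
  also have "\<dots> = (\<Sum>\<^sub>\<infinity>(u, v). Poly_Mapping.lookup p u * Poly_Mapping.lookup q v * Poly_Mapping.lookup (qsh B u v) w)"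
    by (rule infsum_cong_neutral) (auto simp: in_keys_iff)
  finally show ?thesis .
qed

lemma tensor_prod_word_sum:
  "tensor_prod B (word_sum g) (word_sum h) = word_sum (fun_conv B g h)"
  by (intro ext)
     (simp add: tensor_prod_def word_sum_def fun_conv_def lookup_qsh_prod lookup_sum case_prod_beta)

lemma tensor_power_word_sum: "tensor_power B (word_sum g) k = word_sum (fun_power B g k)"
  by (induction k) (simp_all add: pure_tensor_Nil tensor_prod_word_sum)

lemma tensor_power_word_sum_endo:
  "tensor_power B (word_sum (\<lambda>w. X (of_word w))) k u w = Poly_Mapping.lookup (conv_power B X k (of_word w)) u"
  unfolding tensor_power_word_sum conv_power_of_word by (simp add: word_sum_def)

lemma conv_sums_iff_word_sum:
  assumes "has_power_series_on B f c D" "word_sum (\<lambda>w. X (of_word w)) \<in> D" "linear Y"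
  shows "conv_sums B c X Y \<longleftrightarrow> f (word_sum (\<lambda>w. X (of_word w))) = word_sum (\<lambda>w. Y (of_word w))"
proof -
  have f: "(\<lambda>k. c k * Poly_Mapping.lookup (fun_power B (\<lambda>w. X (of_word w)) k w) u)
      sums f (word_sum (\<lambda>w. X (of_word w))) u w" for u w
    using assms(1,2) by (auto simp: has_power_series_on_def tensor_power_word_sum_endo conv_power_of_word)
  show ?thesis
  proof
    assume Y: "conv_sums B c X Y"
    show "f (word_sum (\<lambda>w. X (of_word w))) = word_sum (\<lambda>w. Y (of_word w))"
    proof (intro ext)
      fix u w
      have "(\<lambda>k. c k * Poly_Mapping.lookup (fun_power B (\<lambda>w. X (of_word w)) k w) u)
        sums Poly_Mapping.lookup (Y (of_word w)) u"
        using Y unfolding conv_sums_def conv_power_of_word[symmetric] by blast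
      then show "f (word_sum (\<lambda>w. X (of_word w))) u w = word_sum (\<lambda>w. Y (of_word w)) u w"
        unfolding word_sum_def[of "\<lambda>w. Y (of_word w)"] by (rule sums_unique2[OF f])
    qed
  next
    assume eq: "f (word_sum (\<lambda>w. X (of_word w))) = word_sum (\<lambda>w. Y (of_word w))"
    show "conv_sums B c X Y"
      by (rule conv_sumsI[OF assms(3)]) (use f in \<open>simp add: eq word_sum_def[of "\<lambda>w. Y (of_word w)"]\<close>)
  qed
qed

lemma conv_series_eqI:
  assumes "linear X" "conv_sums B c X Y"
  shows "X \<in> conv_domain B c" "conv_series B c X = Y"
  using assms by (auto simp: conv_domain_def conv_series_eq)

lemma conv_domainE:
  assumes "X \<in> conv_domain B c"
  obtains Y where "linear X" "linear Y" "conv_sums B c X Y" "conv_series B c X = Y"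
  using assms by (auto simp: conv_domain_def conv_series_eq linear_conv_sums)

lemma conv_series_step:
  assumes f: "has_power_series_on B f c D" and g: "has_power_series_on B g b E"
    and fg: "f ` D \<subseteq> E" "\<forall>x\<in>D. g (f x) = x"
    and X: "X \<in> conv_domain B c" "word_sum (\<lambda>w. X (of_word w)) \<in> D"
  shows "conv_series B c X \<in> {Y \<in> conv_domain B b. word_sum (\<lambda>w. Y (of_word w)) \<in> E}
    \<and> conv_series B b (conv_series B c X) = X"
proof -
  from X(1) obtain Y where Y: "linear X" "linear Y" "conv_sums B c X Y" "conv_series B c X = Y"
    by (rule conv_domainE)
  have fX: "f (word_sum (\<lambda>w. X (of_word w))) = word_sum (\<lambda>w. Y (of_word w))"
    using conv_sums_iff_word_sum[OF f X(2) Y(2)] Y(3) by simp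
  then have YE: "word_sum (\<lambda>w. Y (of_word w)) \<in> E" using fg(1) X(2) by (metis image_subset_iff)
  have "g (word_sum (\<lambda>w. Y (of_word w))) = word_sum (\<lambda>w. X (of_word w))"
    using fg(2) X(2) fX by metis
  then have "conv_sums B b Y X"
    using conv_sums_iff_word_sum[OF g YE Y(1)] by simp
  then show ?thesis using YE conv_series_eqI[OF Y(2)] by (simp add: Y(4))
qed

lemma conv_inverse_word_sum:
  assumes f: "has_power_series_on B f c D" and g: "has_power_series_on B g b E"
    and inv: "inverse_maps f g D E"
  shows "conv_inverse B c b
          {X \<in> conv_domain B c. word_sum (\<lambda>w. X (of_word w)) \<in> D}
          {Y \<in> conv_domain B b. word_sum (\<lambda>w. Y (of_word w)) \<in> E}"
proof -
  note step1 = conv_series_step[OF f g] and step2 = conv_series_step[OF g f]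
  show ?thesis
    using inv step1 step2 unfolding conv_inverse_def inverse_maps_def by blast
qed

lemma conv_sums_fps_fun:
  fixes B :: "'a bracket" and g :: "'a list \<Rightarrow> 'a words"
  assumes B: "bilinear B" "\<And>x y z. B (B x y) z = B x (B y z)" and g: "g [] = 0"
    and "fps_sums c \<phi> \<psi>"
  shows "conv_sums B c (lin_ext (fps_fun B g \<phi>)) (lin_ext (fps_fun B g \<psi>))"
proof (rule conv_sumsI[OF linear_lin_ext])
  fix w u
  have "(\<lambda>k. \<Sum>m\<le>length w. c k * fps_nth (\<phi> ^ k) m * Poly_Mapping.lookup (fun_power B g m w) u)
      sums (\<Sum>m\<le>length w. fps_nth \<psi> m * Poly_Mapping.lookup (fun_power B g m w) u)"
    using assms(4) by (intro sums_sum sums_mult2) (auto simp: fps_sums_def)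
  then show "(\<lambda>k. c k * Poly_Mapping.lookup (fun_power B (\<lambda>w. lin_ext (fps_fun B g \<phi>) (of_word w)) k w) u)
      sums Poly_Mapping.lookup (lin_ext (fps_fun B g \<psi>) (of_word w)) u"
    unfolding lin_ext_single fps_fun_power[of B g, OF B g]
    by (simp add: fps_fun_def lookup_sum sum_distrib_left mult.assoc)
qed

lemma linear_eq_fps_fun:
  fixes X :: "'a endo"
  assumes "linear X" "X (of_word []) = t *\<^sub>R of_word []"
  shows "X = lin_ext (fps_fun B (\<lambda>w. X (of_word w) - t *\<^sub>R fun_unit w) (fps_const t + fps_X))"
  unfolding fps_fun_const_plus_X[of "\<lambda>w. X (of_word w)" t B, OF assms(2)]
  by (rule ext, rule linear_eq_lin_ext[OF assms(1)])

lemma endos_at_step: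
  fixes B :: "'a bracket"
  assumes B: "bilinear B" "\<And>x y z. B (B x y) z = B x (B y z)"
    and ex: "\<And>t. t \<in> U \<Longrightarrow> \<exists>\<psi>. fps_nth \<psi> 0 \<in> V \<and> fps_sums c (fps_const t + fps_X) \<psi>
          \<and> fps_sums b \<psi> (fps_const t + fps_X)"
    and X: "X \<in> endos_at U"
  shows "X \<in> conv_domain B c \<and> conv_series B c X \<in> endos_at V
    \<and> conv_series B b (conv_series B c X) = X"
proof -
  from X obtain t where t: "linear X" "t \<in> U" "X (of_word []) = t *\<^sub>R of_word []"
    by (auto simp: endos_at_def)
  from ex[OF t(2)] obtain \<psi> where \<psi>: "fps_nth \<psi> 0 \<in> V" "fps_sums c (fps_const t + fps_X) \<psi>"
    "fps_sums b \<psi> (fps_const t + fps_X)" by blast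
  define g where "g = (\<lambda>w. X (of_word w) - t *\<^sub>R fun_unit w)"
  have g: "g [] = 0" by (simp add: g_def t(3) fun_unit_def)
  have X_eq: "lin_ext (fps_fun B g (fps_const t + fps_X)) = X"
    unfolding g_def by (rule linear_eq_fps_fun[symmetric, OF t(1,3)])
  define Y where "Y = lin_ext (fps_fun B g \<psi>)"
  have XY: "conv_sums B c X Y" and YX: "conv_sums B b Y X"
    using conv_sums_fps_fun[of B g, OF B g \<psi>(2)] conv_sums_fps_fun[of B g, OF B g \<psi>(3)]
    by (simp_all add: X_eq Y_def)
  have "linear Y" by (simp add: Y_def linear_lin_ext)
  moreover have "Y (of_word []) = fps_nth \<psi> 0 *\<^sub>R of_word []"
    by (simp add: Y_def fps_fun_def fun_unit_def)
  ultimately have "Y \<in> endos_at V" using \<psi>(1) by (auto simp: endos_at_def)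
  then show ?thesis
    using conv_series_eqI[OF t(1) XY] conv_series_eq[OF YX] by simp
qed

lemma conv_inverse_endos_at:
  fixes B :: "'a bracket"
  assumes B: "bilinear B" "\<And>x y z. B (B x y) z = B x (B y z)"
    and U: "\<And>t. t \<in> U \<Longrightarrow> \<exists>\<psi>. fps_nth \<psi> 0 \<in> V \<and> fps_sums c (fps_const t + fps_X) \<psi>
          \<and> fps_sums b \<psi> (fps_const t + fps_X)"
    and V: "\<And>t. t \<in> V \<Longrightarrow> \<exists>\<psi>. fps_nth \<psi> 0 \<in> U \<and> fps_sums b (fps_const t + fps_X) \<psi>
          \<and> fps_sums c \<psi> (fps_const t + fps_X)"
  shows "conv_inverse B c b (endos_at U) (endos_at V)"
  using endos_at_step[of B, OF B U] endos_at_step[of B, OF B V]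
  unfolding conv_inverse_def inverse_maps_def by blast

text \<open>The limit at a word \<open>w\<close> has finite support, because all convolution powers of \<open>X\<close> at \<open>w\<close>
  lie in the span of the powers with exponent at most \<open>length w\<close> of \<open>X - t \<nu>\<close>.\<close>

lemma conv_sums_exI:
  fixes B :: "'a bracket"
  assumes B: "bilinear B" "\<And>x y z. B (B x y) z = B x (B y z)"
    and X: "linear X" "X (of_word []) = t *\<^sub>R of_word []"
    and summable: "\<And>w u. summable (\<lambda>k. c k * Poly_Mapping.lookup (conv_power B X k (of_word w)) u)"
  shows "\<exists>Y. conv_sums B c X Y"
proof -
  define g where "g = (\<lambda>w. X (of_word w) - t *\<^sub>R fun_unit w)"
  have g: "g [] = 0" by (simp add: g_def X(2) fun_unit_def)
  have X_eq: "(\<lambda>w. X (of_word w)) = fps_fun B g (fps_const t + fps_X)"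
    unfolding g_def by (rule fps_fun_const_plus_X[of "\<lambda>w. X (of_word w)", symmetric, OF X(2)])
  let ?s = "\<lambda>w u. suminf (\<lambda>k. c k * Poly_Mapping.lookup (conv_power B X k (of_word w)) u)"
  have "finite {u. ?s w u \<noteq> 0}" for w
  proof (rule finite_subset)
    show "finite (\<Union>m\<le>length w. Poly_Mapping.keys (fun_power B g m w))" by simp
    show "{u. ?s w u \<noteq> 0} \<subseteq> (\<Union>m\<le>length w. Poly_Mapping.keys (fun_power B g m w))"
    proof
      fix u assume u: "u \<in> {u. ?s w u \<noteq> 0}"
      show "u \<in> (\<Union>m\<le>length w. Poly_Mapping.keys (fun_power B g m w))"
      proof (rule ccontr)
        assume "u \<notin> (\<Union>m\<le>length w. Poly_Mapping.keys (fun_power B g m w))"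
        then have "Poly_Mapping.lookup (conv_power B X k (of_word w)) u = 0" for k
          unfolding conv_power_of_word X_eq fps_fun_power[of B g, OF B g]
          by (auto simp: fps_fun_def lookup_sum in_keys_iff intro!: sum.neutral)
        then show False using u by simp
      qed
    qed
  qed
  then have "conv_sums B c X (lin_ext (\<lambda>w. Abs_poly_mapping (?s w)))"
    by (intro conv_sumsI linear_lin_ext)
       (use summable in \<open>simp add: conv_power_of_word[symmetric] summable_sums\<close>)
  then show ?thesis by blast
qed

theorem proposition2:
  fixes B :: "'a::countable bracket"
    and f :: "'a ctensor \<Rightarrow> 'a ctensor"
    and c :: "nat \<Rightarrow> real"
    and D :: "'a ctensor set"
  assumes "bilinear B"
    and "\<And>x y. B x y = B y x"
    and "\<And>x y z. B (B x y) z = B x (B y z)"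
    and "has_power_series_on B f c D"
  shows
    "(word_sum of_word \<in> D \<longrightarrow>
        id \<in> conv_domain B c \<and>
        f (word_sum of_word) = word_sum (\<lambda>w. conv_series B c id (of_word w)))
   \<and> (\<forall>g b E.
        has_power_series_on B g b E \<and> inverse_maps f g D E \<longrightarrow>
        conv_inverse B c b
          {X \<in> conv_domain B c. word_sum (\<lambda>w. X (of_word w)) \<in> D}
          {Y \<in> conv_domain B b. word_sum (\<lambda>w. Y (of_word w)) \<in> E})
   \<and> (\<forall>b U V.
        open U \<and> open V \<and>
        (\<forall>t\<in>U. summable (\<lambda>k. c k * t ^ k)) \<and> (\<forall>s\<in>V. summable (\<lambda>k. b k * s ^ k)) \<and>
        inverse_maps (\<lambda>t. suminf (\<lambda>k. c k * t ^ k)) (\<lambda>s. suminf (\<lambda>k. b k * s ^ k)) U V \<longrightarrow>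
        conv_inverse B c b (endos_at U) (endos_at V))
   \<and> (\<forall>b.
        c 0 = 0 \<and> b 0 = 0 \<and>
        Abs_fps b oo Abs_fps c = fps_X \<and> Abs_fps c oo Abs_fps b = fps_X \<longrightarrow>
        conv_inverse B c b (endos_at {0}) (endos_at {0}))"
proof (intro conjI allI impI)
  note B = assms(1,3) and f = assms(4)
  {
    assume D: "word_sum of_word \<in> D"
    then have D': "word_sum (\<lambda>w. id (of_word w)) \<in> D" by simp
    have "\<exists>Y. conv_sums B c id Y"
    proof (rule conv_sums_exI[OF B])
      show "linear (id :: 'a endo)" by (rule linear_id)
      show "id (of_word []) = (1 :: real) *\<^sub>R (of_word [] :: 'a words)" by simp
      show "summable (\<lambda>k. c k * Poly_Mapping.lookup (conv_power B id k (of_word w)) u)" for w u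
      proof (rule sums_summable)
        show "(\<lambda>k. c k * Poly_Mapping.lookup (conv_power B id k (of_word w)) u)
            sums f (word_sum of_word) u w"
          unfolding tensor_power_word_sum_endo[symmetric] id_apply
          using f D by (simp add: has_power_series_on_def)
      qed
    qed
    then obtain Y where Y: "conv_sums B c id Y" ..
    then show "id \<in> conv_domain B c"
      by (rule conv_series_eqI[OF linear_id])
    show "f (word_sum of_word) = word_sum (\<lambda>w. conv_series B c id (of_word w))"
      using conv_sums_iff_word_sum[where X = id, OF f D' linear_conv_sums[OF Y]] Y
      by (simp only: conv_series_eq[OF Y] id_apply)
  }
  show "conv_inverse B c b
          {X \<in> conv_domain B c. word_sum (\<lambda>w. X (of_word w)) \<in> D}
          {Y \<in> conv_domain B b. word_sum (\<lambda>w. Y (of_word w)) \<in> E}"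
    if "has_power_series_on B g b E \<and> inverse_maps f g D E" for g b E
    using that by (intro conv_inverse_word_sum[OF f]) auto
  show "conv_inverse B c b (endos_at U) (endos_at V)"
    if "open U \<and> open V \<and>
        (\<forall>t\<in>U. summable (\<lambda>k. c k * t ^ k)) \<and> (\<forall>s\<in>V. summable (\<lambda>k. b k * s ^ k)) \<and>
        inverse_maps (\<lambda>t. suminf (\<lambda>k. c k * t ^ k)) (\<lambda>s. suminf (\<lambda>k. b k * s ^ k)) U V" for b U V
  proof (rule conv_inverse_endos_at[OF B])
    have U: "open U" "\<And>t. t \<in> U \<Longrightarrow> summable (\<lambda>k. c k * t ^ k)"
      and V: "open V" "\<And>s. s \<in> V \<Longrightarrow> summable (\<lambda>k. b k * s ^ k)"
      and inv: "inverse_maps (\<lambda>t. suminf (\<lambda>k. c k * t ^ k)) (\<lambda>s. suminf (\<lambda>k. b k * s ^ k)) U V"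
      using that by blast+
    show "\<exists>\<psi>. fps_nth \<psi> 0 \<in> V \<and> fps_sums c (fps_const t + fps_X) \<psi>
          \<and> fps_sums b \<psi> (fps_const t + fps_X)" if "t \<in> U" for t
      by (rule fps_sums_inverse[OF U V _ _ that]) (use inv in \<open>auto simp: inverse_maps_def\<close>)
    show "\<exists>\<psi>. fps_nth \<psi> 0 \<in> U \<and> fps_sums b (fps_const t + fps_X) \<psi>
          \<and> fps_sums c \<psi> (fps_const t + fps_X)" if "t \<in> V" for t
      by (rule fps_sums_inverse[OF V U _ _ that]) (use inv in \<open>auto simp: inverse_maps_def\<close>)
  qed
  show "conv_inverse B c b (endos_at {0}) (endos_at {0})"
    if b: "c 0 = 0 \<and> b 0 = 0 \<and>
        Abs_fps b oo Abs_fps c = fps_X \<and> Abs_fps c oo Abs_fps b = fps_X" for b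
  proof (rule conv_inverse_endos_at[OF B])
    have 1: "fps_sums c fps_X (Abs_fps c)" "fps_sums b fps_X (Abs_fps b)"
      using fps_sums_compose[of fps_X c] fps_sums_compose[of fps_X b] by simp_all
    have 2: "fps_sums b (Abs_fps c) fps_X" "fps_sums c (Abs_fps b) fps_X"
      using fps_sums_compose[of "Abs_fps c" b] fps_sums_compose[of "Abs_fps b" c] b by simp_all
    show "\<exists>\<psi>. fps_nth \<psi> 0 \<in> {0} \<and> fps_sums c (fps_const t + fps_X) \<psi>
          \<and> fps_sums b \<psi> (fps_const t + fps_X)" if "t \<in> {0}" for t
      using that 1 2 b by (intro exI[of _ "Abs_fps c"]) simp
    show "\<exists>\<psi>. fps_nth \<psi> 0 \<in> {0} \<and> fps_sums b (fps_const t + fps_X) \<psi>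
          \<and> fps_sums c \<psi> (fps_const t + fps_X)" if "t \<in> {0}" for t
      using that 1 2 b by (intro exI[of _ "Abs_fps b"]) simp
  qed
qed

end
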